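(* Let $d \geq 1$ and $n \geq 1$ be integers with $n \geq 250\, d$, and let $\mathbf{x}_1, \dots, \mathbf{x}_n$ be points in $[0,1]^d$. Then $$ D_n^*(\mathbf{x}_1, \dots, \mathbf{x}_n) \geq \frac{d}{12\,n}. $$
   Context: Let $\mathcal{A}^*$ denote the class of all closed axis-parallel boxes in $[0,1]^d$ which have one vertex at the origin, i.e. the boxes $[\mathbf{0},\mathbf{a}] = [0,a_1]\times\dots\times[0,a_d]$ with $\mathbf{a}=(a_1,\dots,a_d) \in [0,1]^d$. The star-discrepancy of points $\mathbf{x}_1, \dots, \mathbf{x}_n \in [0,1]^d$ is $$ D_n^*(\mathbf{x}_1, \dots, \mathbf{x}_n) = \sup_{A \in \mathcal{A}^*} \left| \frac{1}{n} \sum_{k=1}^n \mathbf{1}_A(\mathbf{x}_k) - \mathrm{vol}(A) \right|, $$ where $\mathbf{1}_A$ is the indicator function of $A$ and $\mathrm{vol}$ is $d$-dimensional Lebesgue measure. The points $\mathbf{x}_1,\dots,\mathbf{x}_n$ are not required to be distinct (they form a multiset, and points are counted with multiplicity). *)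

theory Defs
  imports "HOL-Analysis.Analysis"
begin

definition unit_cube :: "(real ^ 'd::finite) set" where
  "unit_cube = cbox 0 (\<chi> i. 1)"

definition anchored_boxes :: "(real ^ 'd::finite) set set" where
  "anchored_boxes = {cbox 0 a | a. a \<in> unit_cube}"

definition local_discrepancy ::
  "nat \<Rightarrow> (nat \<Rightarrow> real ^ 'd::finite) \<Rightarrow> (real ^ 'd) set \<Rightarrow> real" where
  "local_discrepancy n x A =
     \<bar>(1 / real n) * (\<Sum>k = 1..n. indicator A (x k)) - measure lborel A\<bar>"

definition star_discrepancy :: "nat \<Rightarrow> (nat \<Rightarrow> real ^ 'd::finite) \<Rightarrow> real" where
  "star_discrepancy n x = (SUP A \<in> anchored_boxes. local_discrepancy n x A)"

text \<open>
  The supremum is taken in the conditionally complete lattice of the reals; the next two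
  facts show that it ranges over a nonempty bounded set, so it is the true least upper bound.
\<close>

lemma anchored_boxes_nonempty: "(anchored_boxes :: (real ^ 'd::finite) set set) \<noteq> {}"
proof -
  have "(0 :: real ^ 'd) \<in> unit_cube"
    by (simp add: unit_cube_def mem_box_cart)
  then show ?thesis
    by (auto simp: anchored_boxes_def)
qed

lemma bdd_above_local_discrepancy:
  fixes x :: "nat \<Rightarrow> real ^ 'd::finite"
  shows "bdd_above (local_discrepancy n x ` anchored_boxes)"
proof (rule bdd_aboveI2)
  fix A :: "(real ^ 'd) set"
  assume "A \<in> anchored_boxes"
  then obtain a where A: "A = cbox 0 a" and a: "a \<in> unit_cube"
    by (auto simp: anchored_boxes_def)
  have "A \<subseteq> unit_cube"
    using a unfolding A unit_cube_def by (simp add: mem_box_cart subset_iff) (meson order_trans)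
  then have vol: "measure lborel A \<le> measure lborel (unit_cube :: (real ^ 'd) set)"
    unfolding A unit_cube_def by (intro content_subset)
  have sum_le: "(\<Sum>k = 1..n. indicator A (x k) :: real) \<le> (\<Sum>k = 1..n. 1)"
    by (intro sum_mono) (simp add: indicator_def)
  have "(1 / real n) * (\<Sum>k = 1..n. indicator A (x k)) \<le> 1"
    using sum_le by (cases "n = 0") (simp_all add: divide_simps)
  moreover have "0 \<le> (1 / real n) * (\<Sum>k = 1..n. indicator A (x k))"
    by (simp add: sum_nonneg)
  moreover have "0 \<le> measure lborel A"
    by simp
  ultimately show "local_discrepancy n x A \<le> 1 + measure lborel (unit_cube :: (real ^ 'd) set)"
    using vol unfolding local_discrepancy_def by linarith
qed

end

theory Submission
  imports Defs
begin

text \<open>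
  Put \<open>q = 1 - 1 / (2 n)\<close> and consider the boxes whose upper corner has coordinates \<open>q\<close> on a set
  \<open>S\<close> of directions and \<open>1\<close> elsewhere. Choose \<open>S\<close> maximal such that its box misses at least
  \<open>m = card S\<close> of the points. By maximality, cutting the box in any further direction removes no
  point, so it contains exactly as many points as the cube \<open>[0, q]\<^sup>d\<close>. If \<open>m \<ge> d / 6\<close>, then the box,
  of volume \<open>q\<^sup>m \<ge> 1 - m / (2 n)\<close>, contains too few points. Otherwise the two boxes contain the same
  points, but their volumes \<open>q\<^sup>m\<close> and \<open>q\<^sup>d\<close> differ by more than \<open>d / (6 n)\<close>.
\<close>

definition cut_box :: "real \<Rightarrow> 'd set \<Rightarrow> (real ^ 'd::finite) set" where
  "cut_box q S = cbox 0 (\<chi> i. if i \<in> S then q else 1)"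

lemma mem_cut_box_iff:
  assumes "q \<le> 1"
  shows "v \<in> cut_box q S \<longleftrightarrow> v \<in> unit_cube \<and> (\<forall>i\<in>S. v $ i \<le> q)"
proof -
  have "v $ i \<le> (if i \<in> S then q else 1) \<longleftrightarrow> v $ i \<le> 1 \<and> (i \<in> S \<longrightarrow> v $ i \<le> q)" for i
    using assms by auto
  then show ?thesis
    by (auto simp: cut_box_def unit_cube_def mem_box_cart)
qed

lemma cut_box_in_anchored_boxes:
  assumes "0 \<le> q" "q \<le> 1"
  shows "cut_box q S \<in> anchored_boxes"
  using assms by (auto simp: cut_box_def anchored_boxes_def unit_cube_def mem_box_cart)

lemma measure_cut_box:
  assumes "0 \<le> q"
  shows "measure lborel (cut_box q S) = q ^ card S"
proof -
  have "cut_box q S \<noteq> {}"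
    using assms by (auto simp: cut_box_def interval_ne_empty_cart)
  then show ?thesis
    by (simp add: cut_box_def content_cbox_cart prod.If_cases)
qed

lemma local_discrepancy_le_star_discrepancy:
  assumes "A \<in> anchored_boxes"
  shows "local_discrepancy n x A \<le> star_discrepancy n x"
  unfolding star_discrepancy_def
  using assms bdd_above_local_discrepancy by (intro cSUP_upper)

text \<open>Factor \<open>1 - q ^ k\<close> as \<open>1 - q\<close> times the sum of
  \<open>q ^ j\<close> over \<open>j < k\<close>; each of these \<open>k\<close> powers is at least
  \<open>q ^ k\<close>.\<close>

lemma power_gap:
  fixes q :: real
  assumes "0 \<le> q" "q \<le> 1"
  shows "real k * (1 - q) * q ^ k \<le> 1 - q ^ k"
proof (induction k)
  case (Suc k)
  have "(1 - q) * q ^ Suc k \<le> (1 - q) * 1"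
    using assms by (intro mult_left_mono power_le_one) auto
  moreover have "q * (real k * (1 - q) * q ^ k) \<le> q * (1 - q ^ k)"
    using Suc assms by (intro mult_left_mono)
  ultimately show ?case
    by (simp add: algebra_simps)
qed simp

text \<open>\<open>T S\<close> collects indices rather than points, so that repeated points count
  with multiplicity.\<close>

lemma exists_saturated_cut:
  fixes x :: "nat \<Rightarrow> real ^ 'd::finite" and n :: nat
  assumes q: "q \<le> 1"
  defines "T \<equiv> (\<lambda>S. {k \<in> {1..n}. x k \<in> cut_box q S})"
  obtains S where "card (T S) + card S \<le> n" "T S = T UNIV"
proof -
  have "card (T {}) \<le> card {1..n}"
    unfolding T_def by (intro card_mono) auto
  then have "card (T {}) + card ({} :: 'd set) \<le> n"
    by simp
  moreover have "card S < Suc CARD('d)" for S :: "'d set"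
    by (simp add: card_mono less_Suc_eq_le)
  ultimately obtain S where S: "card (T S) + card S \<le> n"
    and max: "\<And>S'. card (T S') + card S' \<le> n \<Longrightarrow> card S' \<le> card S"
    using ex_has_greatest_nat[of "\<lambda>S. card (T S) + card S \<le> n" "{}" card "Suc CARD('d)"]
    by metis
  have "T (insert i S) = T S" if "i \<notin> S" for i
  proof (rule card_seteq)
    show "T (insert i S) \<subseteq> T S"
      using q by (auto simp: T_def mem_cut_box_iff)
    \<comment> \<open>If the cut in direction \<open>i\<close> lost a point, the loss would offset
      the growth of \<open>card S\<close>, and \<open>insert i S\<close> would contradict
      maximality.\<close>
    show "card (T S) \<le> card (T (insert i S))"
      using S max[of "insert i S"] that by force
  qed (simp add: T_def)
  then have "k \<in> T (insert i S)" if "k \<in> T S" for k i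
    using that by (metis insert_absorb)
  then have "x k $ i \<le> q" if "k \<in> T S" for k i
    using that q by (simp add: T_def mem_cut_box_iff)
  then have "T S = T UNIV"
    using q by (auto simp: T_def mem_cut_box_iff)
  with S that show thesis
    by blast
qed

theorem theorem1:
  fixes x :: "nat \<Rightarrow> real ^ 'd::finite" and n :: nat
  assumes "n \<ge> 1"
    and "n \<ge> 250 * CARD('d)"
    and "\<And>k. k \<in> {1..n} \<Longrightarrow> x k \<in> unit_cube"
  shows "star_discrepancy n x \<ge> real CARD('d) / (12 * real n)"
proof -
  define d where "d = CARD('d)"
  \<comment> \<open>A cut of width \<open>1 / (2 * n)\<close> costs at most half the volume that one
    point accounts for.\<close>
  define q where "q = 1 - 1 / (2 * real n)"
  define N where "N = (\<lambda>S. card {k \<in> {1..n}. x k \<in> cut_box q S})"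
  have q: "0 \<le> q" "q \<le> 1"
    using assms(1) by (auto simp: q_def divide_simps)
  have n: "real n > 0" "real n \<ge> 250 * real d"
    using assms(1,2) unfolding d_def by linarith+
  have disc: "\<bar>real (N S) / real n - q ^ card S\<bar> \<le> star_discrepancy n x" for S
  proof -
    have "(\<Sum>k = 1..n. indicator (cut_box q S) (x k)) = real (N S)"
      by (simp add: N_def indicator_def sum.If_cases Int_def)
    then show ?thesis
      using local_discrepancy_le_star_discrepancy[OF cut_box_in_anchored_boxes[OF q], of n x S]
      by (simp add: local_discrepancy_def measure_cut_box[OF q(1)])
  qed
  have bernoulli: "1 - real k / (2 * real n) \<le> q ^ k" for k
    using Bernoulli_inequality[of "- (1 / (2 * real n))" k] q
    by (simp add: q_def)
  obtain S where "card {k \<in> {1..n}. x k \<in> cut_box q S} + card S \<le> n"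
    "{k \<in> {1..n}. x k \<in> cut_box q S} = {k \<in> {1..n}. x k \<in> cut_box q UNIV}"
    by (rule exists_saturated_cut[OF q(2)])
  then have S: "N S + card S \<le> n" "N S = N UNIV"
    by (simp_all only: N_def)
  define m where "m = card S"
  have "m \<le> d"
    by (simp add: m_def d_def card_mono)
  show ?thesis
  proof (cases "real d \<le> 6 * real m")
    \<comment> \<open>Missing \<open>m\<close> points costs \<open>m / n\<close>, the cuts at most
      \<open>m / (2 * n)\<close> of volume; the threshold \<open>d / 6\<close> turns the difference
      into \<open>d / (12 * n)\<close>.\<close>
    case True
    have "real (N S) / real n \<le> 1 - real m / real n"
      using S(1) n by (simp add: m_def field_simps flip: of_nat_add)
    then have "real m / (2 * real n) \<le> star_discrepancy n x"
      using disc[of S] bernoulli[of m] by (simp add: m_def abs_le_iff)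
    moreover have "real d / (12 * real n) \<le> real m / (2 * real n)"
      using True n by (simp add: field_simps)
    ultimately show ?thesis
      by (simp add: d_def)
  next
    case False
    have "499 / 500 \<le> q ^ d"
    proof -
      have "real d / (2 * real n) \<le> 1 / 500"
        using n by (simp add: field_simps)
      then show ?thesis
        using bernoulli[of d] by linarith
    qed
    \<comment> \<open>The three factors bound \<open>d - m\<close>, \<open>1 - q\<close> and
      \<open>q ^ d\<close> from below; the first uses \<open>m < d / 6\<close>.\<close>
    then have "(5 / 6 * real d) * (1 / (2 * real n)) * (499 / 500)
        \<le> real (d - m) * (1 - q) * q ^ d"
      using False \<open>m \<le> d\<close> by (intro mult_mono) (auto simp: q_def)
    moreover have "real d / (6 * real n) \<le> (5 / 6 * real d) * (1 / (2 * real n)) * (499 / 500)"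
      using n by (simp add: field_simps)
    ultimately have "real d / (6 * real n) \<le> real (d - m) * (1 - q) * q ^ d"
      by linarith
    also have "\<dots> = q ^ m * (real (d - m) * (1 - q) * q ^ (d - m))"
      using \<open>m \<le> d\<close> by (simp flip: power_add)
    also have "\<dots> \<le> q ^ m * (1 - q ^ (d - m))"
      using q by (intro mult_left_mono power_gap) auto
    also have "\<dots> = q ^ m - q ^ d"
      using \<open>m \<le> d\<close> by (simp add: right_diff_distrib flip: power_add)
    \<comment> \<open>Both volumes are compared with the same fraction of points, so the triangle
      inequality applies.\<close>
    also have "\<dots> \<le> 2 * star_discrepancy n x"
      using disc[of S] disc[of UNIV] S(2) by (simp add: m_def d_def abs_le_iff)
    finally show ?thesis
      by (simp add: d_def)
  qed
qed

end
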